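(* Let $\Omega$ be a commutative semigroup, let $(V;\rho,\theta)$ be a representation of a Lie-Yamaguti algebra $(L,[\cdot,\cdot],\{\cdot,\cdot,\cdot\})$, let $\Gamma=(\Gamma_1,\Gamma_2)$ be a $(2,3)$-cocycle of $L$ with coefficients in $V$, and let $\{T_\alpha:V\to L\}_{\alpha\in\Omega}$ be a $\Gamma$-twisted Rota-Baxter family. Then $V$, with the operations $$u\bullet_\alpha v=\rho(T_\alpha u)v,\qquad u\vee_{\alpha,\beta}v=\Gamma_1(T_\alpha u,T_\beta v),$$ $$\{u,v,w\}_{\beta,\gamma}=\theta(T_\beta v,T_\gamma w)u,\qquad [u,v,w]_{\alpha,\beta,\gamma}=\Gamma_2(T_\alpha u,T_\beta v,T_\gamma w)$$ for all $u,v,w\in V$ and $\alpha,\beta,\gamma\in\Omega$, is an NS-Lie-Yamaguti family algebra. Furthermore, let $(V';\rho',\theta')$ be a representation of a Lie-Yamaguti algebra $L'$, $\Gamma'=(\Gamma'_1,\Gamma'_2)$ a $(2,3)$-cocycle of $L'$ with coefficients in $V'$, and $\{T'_\alpha:V'\to L'\}_{\alpha\in\Omega}$ a $\Gamma'$-twisted Rota-Baxter family. If $(\zeta,\eta)$ is a morphism of twisted Rota-Baxter families from $\{T_\alpha\}_{\alpha\in\Omega}$ to $\{T'_\alpha\}_{\alpha\in\Omega}$, then $\zeta:V\to V'$ is a morphism between the induced NS-Lie-Yamaguti family algebras.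
   Context: All vector spaces are over an algebraically closed field $\mathbb K$ of characteristic different from $2$ and $3$. **Lie-Yamaguti algebra.** A vector space $L$ with a bilinear bracket $[\cdot,\cdot]:\wedge^2L\to L$ and a trilinear bracket $\{\cdot,\cdot,\cdot\}:\wedge^2L\otimes L\to L$ (skew-symmetric in the first two arguments) such that for all $x,y,z,a,b\in L$: (1) $[[x,y],z]+[[y,z],x]+[[z,x],y]+\{x,y,z\}+\{z,x,y\}+\{y,z,x\}=0$; (2) $\{[x,y],z,a\}+\{[y,z],x,a\}+\{[z,x],y,a\}=0$; (3) $\{a,b,[x,y]\}=[\{a,b,x\},y]+[x,\{a,b,y\}]$; (4) $\{a,b,\{x,y,z\}\}=\{\{a,b,x\},y,z\}+\{x,\{a,b,y\},z\}+\{x,y,\{a,b,z\}\}$. A homomorphism is a linear map preserving both brackets. **Representation.** A representation of $L$ on a vector space $V$ is a linear map $\rho:L\to\mathrm{End}(V)$ and a bilinear map $\theta:L\times L\to\mathrm{End}(V)$ such that, with $D(x,y)=\theta(y,x)-\theta(x,y)-\rho([x,y])+\rho(x)\rho(y)-\rho(y)\rho(x)$, for all $x,y,z,a,b\in L$: $\theta([x,y],z)-\theta(x,z)\rho(y)+\theta(y,z)\rho(x)=0$; $D(x,y)\rho(z)-\rho(z)D(x,y)-\rho(\{x,y,z\})=0$; $\theta(x,[y,z])-\rho(y)\theta(x,z)+\rho(z)\theta(x,y)=0$; $D(a,b)\theta(x,y)-\theta(x,y)D(a,b)-\theta(\{a,b,x\},y)-\theta(x,\{a,b,y\})=0$; $\theta(a,\{x,y,z\})-\theta(y,z)\theta(a,x)+\theta(x,z)\theta(a,y)-D(x,y)\theta(a,z)=0$.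 **$(2,3)$-cocycle.** A pair $\Gamma=(\Gamma_1,\Gamma_2)\in\mathrm{Hom}(\wedge^2L,V)\times\mathrm{Hom}(\wedge^2L\otimes L,V)$ such that for all $x_1,y_1,x_2,y_2,z\in L$: $-\rho(x_1)\Gamma_1(y_1,z)-\rho(y_1)\Gamma_1(z,x_1)-\rho(z)\Gamma_1(x_1,y_1)+\Gamma_1([x_1,y_1],z)+\Gamma_1([y_1,z],x_1)+\Gamma_1([z,x_1],y_1)+\Gamma_2(x_1,y_1,z)+\Gamma_2(y_1,z,x_1)+\Gamma_2(z,x_1,y_1)=0$; $\theta(x_1,y_2)\Gamma_1(y_1,x_2)+\theta(y_1,y_2)\Gamma_1(x_2,x_1)+\theta(x_2,y_2)\Gamma_1(x_1,y_1)+\Gamma_2([x_1,y_1],x_2,y_2)+\Gamma_2([y_1,x_2],x_1,y_2)+\Gamma_2([x_2,x_1],y_1,y_2)=0$; $-\rho(x_2)\Gamma_2(x_1,y_1,y_2)+\rho(y_2)\Gamma_2(x_1,y_1,x_2)+\Gamma_2(x_1,y_1,[x_2,y_2])+D(x_1,y_1)\Gamma_1(x_2,y_2)-\Gamma_1(\{x_1,y_1,x_2\},y_2)-\Gamma_1(x_2,\{x_1,y_1,y_2\})=0$; $-\theta(y_2,z)\Gamma_2(x_1,y_1,x_2)+\theta(x_2,z)\Gamma_2(x_1,y_1,y_2)+D(x_1,y_1)\Gamma_2(x_2,y_2,z)-D(x_2,y_2)\Gamma_2(x_1,y_1,z)-\Gamma_2(\{x_1,y_1,x_2\},y_2,z)-\Gamma_2(x_2,\{x_1,y_1,y_2\},z)+\Gamma_2(x_1,y_1,\{x_2,y_2,z\})-\Gamma_2(x_2,y_2,\{x_1,y_1,z\})=0$.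 **$\Gamma$-twisted Rota-Baxter family.** A collection of linear maps $\{T_\alpha:V\to L\}_{\alpha\in\Omega}$ such that for all $u,v,w\in V$, $\alpha,\beta,\gamma\in\Omega$: $[T_\alpha u,T_\beta v]=T_{\alpha\beta}\big(\rho(T_\alpha u)v-\rho(T_\beta v)u+\Gamma_1(T_\alpha u,T_\beta v)\big)$; $\{T_\alpha u,T_\beta v,T_\gamma w\}=T_{\alpha\beta\gamma}\big(D(T_\alpha u,T_\beta v)w-\theta(T_\alpha u,T_\gamma w)v+\theta(T_\beta v,T_\gamma w)u+\Gamma_2(T_\alpha u,T_\beta v,T_\gamma w)\big)$. **Morphism of twisted Rota-Baxter families** from $\{T_\alpha\}$ (for $L,V,\Gamma$) to $\{T'_\alpha\}$ (for $L',V',\Gamma'$): a pair $(\zeta,\eta)$ with $\eta:L\to L'$ a Lie-Yamaguti homomorphism and $\zeta:V\to V'$ linear such that $\eta\circ T_\alpha=T'_\alpha\circ\zeta$ for all $\alpha$, $\zeta\circ\Gamma_1=\Gamma'_1\circ(\eta\otimes\eta)$, $\zeta\circ\Gamma_2=\Gamma'_2\circ(\eta\otimes\eta\otimes\eta)$, $\zeta(\rho(x)u)=\rho'(\eta(x))\zeta(u)$ and $\zeta(\theta(x,y)u)=\theta'(\eta(x),\eta(y))\zeta(u)$ for all $x,y\in L$, $u\in V$. **NS-Lie-Yamaguti family algebra** (indexed by $\Omega$). A vector space $A$ with bilinear operations $\bullet_\alpha,\vee_{\alpha,\beta}:A\otimes A\to A$ and trilinear operations $\{\cdot,\cdot,\cdot\}_{\beta,\gamma},[\cdot,\cdot,\cdot]_{\alpha,\beta,\gamma}:A^{\otimes3}\to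 A$ ($\alpha,\beta,\gamma\in\Omega$) with $x\vee_{\alpha,\beta}y=-y\vee_{\beta,\alpha}x$ and $[x,y,z]_{\alpha,\beta,\gamma}=-[y,x,z]_{\beta,\alpha,\gamma}$, such that, setting $[x,y]^*_{\alpha,\beta}=x\bullet_\alpha y-y\bullet_\beta x+x\vee_{\alpha,\beta}y$, $\{x,y,z\}^*_{\alpha,\beta}=\{z,y,x\}_{\beta,\alpha}-\{z,x,y\}_{\alpha,\beta}+x\bullet_\alpha(y\bullet_\beta z)-y\bullet_\beta(x\bullet_\alpha z)-[x,y]^*_{\alpha,\beta}\bullet_{\alpha\beta}z$, $[\![x,y,z]\!]_{\alpha,\beta,\gamma}=\{x,y,z\}^*_{\alpha,\beta}+\{x,y,z\}_{\beta,\gamma}-\{y,x,z\}_{\alpha,\gamma}+[x,y,z]_{\alpha,\beta,\gamma}$, the following hold for all $x,y,z,a,b\in A$ and $\alpha,\beta,\gamma,\varsigma,\tau\in\Omega$: (N1) $\{a,[x,y]^*_{\alpha,\beta},z\}_{\alpha\beta,\gamma}-\{y\bullet_\beta a,x,z\}_{\alpha,\gamma}+\{x\bullet_\alpha a,y,z\}_{\beta,\gamma}=0$; (N2) $\{x,y,z\bullet_\gamma a\}^*_{\alpha,\beta}-z\bullet_\gamma\{x,y,a\}^*_{\alpha,\beta}-[\![x,y,z]\!]_{\alpha,\beta,\gamma}\bullet_{\alpha\beta\gamma}a=0$; (N3) $\{a,x,[y,z]^*_{\beta,\gamma}\}_{\alpha,\beta\gamma}-y\bullet_\beta\{a,x,z\}_{\alpha,\gamma}+z\bullet_\gamma\{a,x,y\}_{\alpha,\beta}=0$;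 (N4) $\{x,y,\{b,z,a\}_{\gamma,\varsigma}\}^*_{\alpha,\beta}-\{\{x,y,b\}^*_{\alpha,\beta},z,a\}_{\gamma,\varsigma}-\{b,[\![x,y,z]\!]_{\alpha,\beta,\gamma},a\}_{\alpha\beta\gamma,\varsigma}-\{b,z,[\![x,y,a]\!]_{\alpha,\beta,\varsigma}\}_{\gamma,\alpha\beta\varsigma}=0$; (N5) $\{b,x,[\![y,z,a]\!]_{\beta,\gamma,\varsigma}\}_{\alpha,\beta\gamma\varsigma}-\{\{b,x,y\}_{\alpha,\beta},z,a\}_{\gamma,\varsigma}+\{\{b,x,z\}_{\alpha,\gamma},y,a\}_{\beta,\varsigma}-\{y,z,\{b,x,a\}_{\alpha,\varsigma}\}^*_{\beta,\gamma}=0$; (N6) $[x,y]^*_{\alpha,\beta}\vee_{\alpha\beta,\gamma}z+[y,z]^*_{\beta,\gamma}\vee_{\beta\gamma,\alpha}x+[z,x]^*_{\gamma,\alpha}\vee_{\gamma\alpha,\beta}y-z\bullet_\gamma(x\vee_{\alpha,\beta}y)-x\bullet_\alpha(y\vee_{\beta,\gamma}z)-y\bullet_\beta(z\vee_{\gamma,\alpha}x)+[x,y,z]_{\alpha,\beta,\gamma}+[y,z,x]_{\beta,\gamma,\alpha}+[z,x,y]_{\gamma,\alpha,\beta}=0$; (N7) $\{x\vee_{\alpha,\beta}y,z,a\}_{\gamma,\varsigma}+\{y\vee_{\beta,\gamma}z,x,a\}_{\alpha,\varsigma}+\{z\vee_{\gamma,\alpha}x,y,a\}_{\beta,\varsigma}+[[x,y]^*_{\alpha,\beta},z,a]_{\alpha\beta,\gamma,\varsigma}+[[y,z]^*_{\beta,\gamma},x,a]_{\beta\gamma,\alpha,\varsigma}+[[z,x]^*_{\gamma,\alpha},y,a]_{\gamma\alpha,\beta,\varsigma}=0$;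 (N8) $-z\bullet_\gamma[x,y,a]_{\alpha,\beta,\varsigma}+a\bullet_\varsigma[x,y,z]_{\alpha,\beta,\gamma}+[x,y,[z,a]^*_{\gamma,\varsigma}]_{\alpha,\beta,\gamma\varsigma}+\{x,y,z\vee_{\gamma,\varsigma}a\}^*_{\alpha,\beta}-[\![x,y,z]\!]_{\alpha,\beta,\gamma}\vee_{\alpha\beta\gamma,\varsigma}a-z\vee_{\gamma,\alpha\beta\varsigma}[\![x,y,a]\!]_{\alpha,\beta,\varsigma}=0$; (N9) $-\{[x,y,z]_{\alpha,\beta,\gamma},a,b\}_{\varsigma,\tau}+\{[x,y,a]_{\alpha,\beta,\varsigma},z,b\}_{\gamma,\tau}+\{x,y,[z,a,b]_{\gamma,\varsigma,\tau}\}^*_{\alpha,\beta}-\{z,a,[x,y,b]_{\alpha,\beta,\tau}\}^*_{\gamma,\varsigma}-[[\![x,y,z]\!]_{\alpha,\beta,\gamma},a,b]_{\alpha\beta\gamma,\varsigma,\tau}-[z,[\![x,y,a]\!]_{\alpha,\beta,\varsigma},b]_{\gamma,\alpha\beta\varsigma,\tau}+[x,y,[\![z,a,b]\!]_{\gamma,\varsigma,\tau}]_{\alpha,\beta,\gamma\varsigma\tau}-[z,a,[\![x,y,b]\!]_{\alpha,\beta,\tau}]_{\gamma,\varsigma,\alpha\beta\tau}=0$. A morphism of NS-Lie-Yamaguti family algebras is a linear map preserving all operations $\bullet_\alpha,\vee_{\alpha,\beta},\{\cdot,\cdot,\cdot\}_{\beta,\gamma},[\cdot,\cdot,\cdot]_{\alpha,\beta,\gamma}$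 for all indices. *)

theory Defs
  imports "HOL-Computational_Algebra.Polynomial"
begin

text \<open>
  A vector space over a field \<open>'k\<close> is a type together with a scalar multiplication
  satisfying the library predicate \<open>vector_space\<close>. Multilinear maps are curried, and a map out
  of \<open>\<And>\<^sup>2L\<close> or \<open>\<And>\<^sup>2L \<otimes> L\<close> is a multilinear map that is skew-symmetric in its first two
  arguments (the characteristic is never 2 where this is used).
\<close>

definition bilinear_map ::
  "('k::field \<Rightarrow> 'a::ab_group_add \<Rightarrow> 'a) \<Rightarrow> ('k \<Rightarrow> 'b::ab_group_add \<Rightarrow> 'b) \<Rightarrow>
   ('k \<Rightarrow> 'c::ab_group_add \<Rightarrow> 'c) \<Rightarrow> ('a \<Rightarrow> 'b \<Rightarrow> 'c) \<Rightarrow> bool"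
  where "bilinear_map sa sb sc f \<longleftrightarrow>
    (\<forall>x. Vector_Spaces.linear sb sc (\<lambda>y. f x y)) \<and>
    (\<forall>y. Vector_Spaces.linear sa sc (\<lambda>x. f x y))"

definition trilinear_map ::
  "('k::field \<Rightarrow> 'a::ab_group_add \<Rightarrow> 'a) \<Rightarrow> ('k \<Rightarrow> 'b::ab_group_add \<Rightarrow> 'b) \<Rightarrow>
   ('k \<Rightarrow> 'c::ab_group_add \<Rightarrow> 'c) \<Rightarrow> ('k \<Rightarrow> 'd::ab_group_add \<Rightarrow> 'd) \<Rightarrow>
   ('a \<Rightarrow> 'b \<Rightarrow> 'c \<Rightarrow> 'd) \<Rightarrow> bool"
  where "trilinear_map sa sb sc sd f \<longleftrightarrow>
    (\<forall>x y. Vector_Spaces.linear sc sd (\<lambda>z. f x y z)) \<and>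
    (\<forall>x z. Vector_Spaces.linear sb sd (\<lambda>y. f x y z)) \<and>
    (\<forall>y z. Vector_Spaces.linear sa sd (\<lambda>x. f x y z))"


section \<open>Lie-Yamaguti algebras\<close>

locale lie_yamaguti = vector_space sL
  for sL :: "'k::field \<Rightarrow> 'l::ab_group_add \<Rightarrow> 'l" +
  fixes br :: "'l \<Rightarrow> 'l \<Rightarrow> 'l"
    and tri :: "'l \<Rightarrow> 'l \<Rightarrow> 'l \<Rightarrow> 'l"
  assumes br_bilinear: "bilinear_map sL sL sL br"
    and tri_trilinear: "trilinear_map sL sL sL sL tri"
    and br_skew: "br x y = - br y x"
    and tri_skew: "tri x y z = - tri y x z"
    and LY1: "br (br x y) z + br (br y z) x + br (br z x) y
              + tri x y z + tri z x y + tri y z x = 0"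
    and LY2: "tri (br x y) z a + tri (br y z) x a + tri (br z x) y a = 0"
    and LY3: "tri a b (br x y) = br (tri a b x) y + br x (tri a b y)"
    and LY4: "tri a b (tri x y z) = tri (tri a b x) y z + tri x (tri a b y) z + tri x y (tri a b z)"

locale lie_yamaguti_hom =
  source: lie_yamaguti sL br tri + target: lie_yamaguti sL' br' tri' +
  Vector_Spaces.linear sL sL' \<eta>
  for sL :: "'k::field \<Rightarrow> 'l::ab_group_add \<Rightarrow> 'l" and br tri
    and sL' :: "'k \<Rightarrow> 'm::ab_group_add \<Rightarrow> 'm" and br' tri'
    and \<eta> :: "'l \<Rightarrow> 'm" +
  assumes hom_br: "\<eta> (br x y) = br' (\<eta> x) (\<eta> y)"
    and hom_tri: "\<eta> (tri x y z) = tri' (\<eta> x) (\<eta> y) (\<eta> z)"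


section \<open>Representations and $(2,3)$-cocycles\<close>

locale ly_rep_ops =
  fixes br :: "'l \<Rightarrow> 'l \<Rightarrow> 'l"
    and \<rho> :: "'l \<Rightarrow> 'v \<Rightarrow> 'v::ab_group_add"
    and \<theta> :: "'l \<Rightarrow> 'l \<Rightarrow> 'v \<Rightarrow> 'v"
begin

definition D :: "'l \<Rightarrow> 'l \<Rightarrow> 'v \<Rightarrow> 'v"
  where "D x y v = \<theta> y x v - \<theta> x y v - \<rho> (br x y) v + \<rho> x (\<rho> y v) - \<rho> y (\<rho> x v)"

end

text \<open>
  Bilinearity of \<open>\<rho>\<close> as a map \<open>L \<times> V \<rightarrow> V\<close> says that \<open>\<rho>\<close> is a linear map
  \<open>L \<rightarrow> End(V)\<close>; likewise trilinearity of \<open>\<theta>\<close>. Identities in \<open>End(V)\<close> are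
  stated after evaluation at an arbitrary vector.
\<close>

locale ly_representation =
  lie_yamaguti sL br tri + V: vector_space sV + ly_rep_ops br \<rho> \<theta>
  for sL :: "'k::field \<Rightarrow> 'l::ab_group_add \<Rightarrow> 'l" and br tri
    and sV :: "'k \<Rightarrow> 'v::ab_group_add \<Rightarrow> 'v"
    and \<rho> :: "'l \<Rightarrow> 'v \<Rightarrow> 'v" and \<theta> :: "'l \<Rightarrow> 'l \<Rightarrow> 'v \<Rightarrow> 'v" +
  assumes \<rho>_bilinear: "bilinear_map sL sV sV \<rho>"
    and \<theta>_trilinear: "trilinear_map sL sL sV sV \<theta>"
    and rep1: "\<theta> (br x y) z v - \<theta> x z (\<rho> y v) + \<theta> y z (\<rho> x v) = 0"
    and rep2: "D x y (\<rho> z v) - \<rho> z (D x y v) - \<rho> (tri x y z) v = 0"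
    and rep3: "\<theta> x (br y z) v - \<rho> y (\<theta> x z v) + \<rho> z (\<theta> x y v) = 0"
    and rep4: "D a b (\<theta> x y v) - \<theta> x y (D a b v) - \<theta> (tri a b x) y v - \<theta> x (tri a b y) v = 0"
    and rep5: "\<theta> a (tri x y z) v - \<theta> y z (\<theta> a x v) + \<theta> x z (\<theta> a y v) - D x y (\<theta> a z v) = 0"

locale ly_cocycle = ly_representation sL br tri sV \<rho> \<theta>
  for sL :: "'k::field \<Rightarrow> 'l::ab_group_add \<Rightarrow> 'l" and br tri
    and sV :: "'k \<Rightarrow> 'v::ab_group_add \<Rightarrow> 'v" and \<rho> \<theta> +
  fixes \<Gamma>1 :: "'l \<Rightarrow> 'l \<Rightarrow> 'v"
    and \<Gamma>2 :: "'l \<Rightarrow> 'l \<Rightarrow> 'l \<Rightarrow> 'v"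
  assumes \<Gamma>1_bilinear: "bilinear_map sL sL sV \<Gamma>1"
    and \<Gamma>2_trilinear: "trilinear_map sL sL sL sV \<Gamma>2"
    and \<Gamma>1_skew: "\<Gamma>1 x y = - \<Gamma>1 y x"
    and \<Gamma>2_skew: "\<Gamma>2 x y z = - \<Gamma>2 y x z"
    and cocycle1:
      "- \<rho> x1 (\<Gamma>1 y1 z) - \<rho> y1 (\<Gamma>1 z x1) - \<rho> z (\<Gamma>1 x1 y1)
       + \<Gamma>1 (br x1 y1) z + \<Gamma>1 (br y1 z) x1 + \<Gamma>1 (br z x1) y1
       + \<Gamma>2 x1 y1 z + \<Gamma>2 y1 z x1 + \<Gamma>2 z x1 y1 = 0"
    and cocycle2:
      "\<theta> x1 y2 (\<Gamma>1 y1 x2) + \<theta> y1 y2 (\<Gamma>1 x2 x1) + \<theta> x2 y2 (\<Gamma>1 x1 y1)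
       + \<Gamma>2 (br x1 y1) x2 y2 + \<Gamma>2 (br y1 x2) x1 y2 + \<Gamma>2 (br x2 x1) y1 y2 = 0"
    and cocycle3:
      "- \<rho> x2 (\<Gamma>2 x1 y1 y2) + \<rho> y2 (\<Gamma>2 x1 y1 x2) + \<Gamma>2 x1 y1 (br x2 y2)
       + D x1 y1 (\<Gamma>1 x2 y2) - \<Gamma>1 (tri x1 y1 x2) y2 - \<Gamma>1 x2 (tri x1 y1 y2) = 0"
    and cocycle4:
      "- \<theta> y2 z (\<Gamma>2 x1 y1 x2) + \<theta> x2 z (\<Gamma>2 x1 y1 y2)
       + D x1 y1 (\<Gamma>2 x2 y2 z) - D x2 y2 (\<Gamma>2 x1 y1 z)
       - \<Gamma>2 (tri x1 y1 x2) y2 z - \<Gamma>2 x2 (tri x1 y1 y2) z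
       + \<Gamma>2 x1 y1 (tri x2 y2 z) - \<Gamma>2 x2 y2 (tri x1 y1 z) = 0"


section \<open>Twisted Rota-Baxter families\<close>

locale twisted_rota_baxter_family = ly_cocycle sL br tri sV \<rho> \<theta> \<Gamma>1 \<Gamma>2
  for sL :: "'k::field \<Rightarrow> 'l::ab_group_add \<Rightarrow> 'l" and br tri
    and sV :: "'k \<Rightarrow> 'v::ab_group_add \<Rightarrow> 'v" and \<rho> \<theta> \<Gamma>1 \<Gamma>2 +
  fixes T :: "'o::ab_semigroup_mult \<Rightarrow> 'v \<Rightarrow> 'l"
  assumes T_linear: "Vector_Spaces.linear sV sL (T \<alpha>)"
    and T_br: "br (T \<alpha> u) (T \<beta> v) =
      T (\<alpha> * \<beta>) (\<rho> (T \<alpha> u) v - \<rho> (T \<beta> v) u + \<Gamma>1 (T \<alpha> u) (T \<beta> v))"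
    and T_tri: "tri (T \<alpha> u) (T \<beta> v) (T \<gamma> w) =
      T (\<alpha> * \<beta> * \<gamma>) (D (T \<alpha> u) (T \<beta> v) w - \<theta> (T \<alpha> u) (T \<gamma> w) v + \<theta> (T \<beta> v) (T \<gamma> w) u
                   + \<Gamma>2 (T \<alpha> u) (T \<beta> v) (T \<gamma> w))"

locale twisted_rota_baxter_family_morphism =
  source: twisted_rota_baxter_family sL br tri sV \<rho> \<theta> \<Gamma>1 \<Gamma>2 T +
  target: twisted_rota_baxter_family sL' br' tri' sV' \<rho>' \<theta>' \<Gamma>1' \<Gamma>2' T' +
  \<eta>: lie_yamaguti_hom sL br tri sL' br' tri' \<eta> +
  \<zeta>: Vector_Spaces.linear sV sV' \<zeta>
  for sL :: "'k::field \<Rightarrow> 'l::ab_group_add \<Rightarrow> 'l" and br tri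
    and sV :: "'k \<Rightarrow> 'v::ab_group_add \<Rightarrow> 'v" and \<rho> \<theta> \<Gamma>1 \<Gamma>2
    and T :: "'o::ab_semigroup_mult \<Rightarrow> 'v \<Rightarrow> 'l"
    and sL' :: "'k \<Rightarrow> 'm::ab_group_add \<Rightarrow> 'm" and br' tri'
    and sV' :: "'k \<Rightarrow> 'w::ab_group_add \<Rightarrow> 'w" and \<rho>' \<theta>' \<Gamma>1' \<Gamma>2'
    and T' :: "'o \<Rightarrow> 'w \<Rightarrow> 'm"
    and \<zeta> :: "'v \<Rightarrow> 'w" and \<eta> :: "'l \<Rightarrow> 'm" +
  assumes T_comm: "\<eta> \<circ> T \<alpha> = T' \<alpha> \<circ> \<zeta>"
    and \<Gamma>1_comm: "\<zeta> (\<Gamma>1 x y) = \<Gamma>1' (\<eta> x) (\<eta> y)"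
    and \<Gamma>2_comm: "\<zeta> (\<Gamma>2 x y z) = \<Gamma>2' (\<eta> x) (\<eta> y) (\<eta> z)"
    and \<rho>_comm: "\<zeta> (\<rho> x u) = \<rho>' (\<eta> x) (\<zeta> u)"
    and \<theta>_comm: "\<zeta> (\<theta> x y u) = \<theta>' (\<eta> x) (\<eta> y) (\<zeta> u)"


section \<open>NS-Lie-Yamaguti family algebras\<close>

text \<open>
  The indices come first: \<open>bul \<alpha> x y\<close> is $x \bullet_\alpha y$, \<open>vee \<alpha> \<beta> x y\<close> is
  $x \vee_{\alpha,\beta} y$, \<open>cur \<beta> \<gamma> x y z\<close> is $\{x,y,z\}_{\beta,\gamma}$ (indexed by the
  labels of its last two arguments), \<open>sqb \<alpha> \<beta> \<gamma> x y z\<close> is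
  $[x,y,z]_{\alpha,\beta,\gamma}$; the derived operations \<open>br_star\<close>, \<open>cur_star\<close>, \<open>dbl\<close> are
  $[x,y]^*_{\alpha,\beta}$, $\{x,y,z\}^*_{\alpha,\beta}$ and the double bracket
  indexed by $\alpha,\beta,\gamma$.
\<close>

locale ns_family_ops =
  fixes bul :: "'o::ab_semigroup_mult \<Rightarrow> 'a::ab_group_add \<Rightarrow> 'a \<Rightarrow> 'a"
    and vee :: "'o \<Rightarrow> 'o \<Rightarrow> 'a \<Rightarrow> 'a \<Rightarrow> 'a"
    and cur :: "'o \<Rightarrow> 'o \<Rightarrow> 'a \<Rightarrow> 'a \<Rightarrow> 'a \<Rightarrow> 'a"
    and sqb :: "'o \<Rightarrow> 'o \<Rightarrow> 'o \<Rightarrow> 'a \<Rightarrow> 'a \<Rightarrow> 'a \<Rightarrow> 'a"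
begin

definition br_star :: "'o \<Rightarrow> 'o \<Rightarrow> 'a \<Rightarrow> 'a \<Rightarrow> 'a"
  where "br_star \<alpha> \<beta> x y = bul \<alpha> x y - bul \<beta> y x + vee \<alpha> \<beta> x y"

definition cur_star :: "'o \<Rightarrow> 'o \<Rightarrow> 'a \<Rightarrow> 'a \<Rightarrow> 'a \<Rightarrow> 'a"
  where "cur_star \<alpha> \<beta> x y z =
    cur \<beta> \<alpha> z y x - cur \<alpha> \<beta> z x y + bul \<alpha> x (bul \<beta> y z) - bul \<beta> y (bul \<alpha> x z)
    - bul (\<alpha> * \<beta>) (br_star \<alpha> \<beta> x y) z"

definition dbl :: "'o \<Rightarrow> 'o \<Rightarrow> 'o \<Rightarrow> 'a \<Rightarrow> 'a \<Rightarrow> 'a \<Rightarrow> 'a"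
  where "dbl \<alpha> \<beta> \<gamma> x y z =
    cur_star \<alpha> \<beta> x y z + cur \<beta> \<gamma> x y z - cur \<alpha> \<gamma> y x z + sqb \<alpha> \<beta> \<gamma> x y z"

end

locale ns_lie_yamaguti_family = vector_space sA + ns_family_ops bul vee cur sqb
  for sA :: "'k::field \<Rightarrow> 'a::ab_group_add \<Rightarrow> 'a"
    and bul :: "'o::ab_semigroup_mult \<Rightarrow> 'a \<Rightarrow> 'a \<Rightarrow> 'a"
    and vee :: "'o \<Rightarrow> 'o \<Rightarrow> 'a \<Rightarrow> 'a \<Rightarrow> 'a"
    and cur :: "'o \<Rightarrow> 'o \<Rightarrow> 'a \<Rightarrow> 'a \<Rightarrow> 'a \<Rightarrow> 'a"
    and sqb :: "'o \<Rightarrow> 'o \<Rightarrow> 'o \<Rightarrow> 'a \<Rightarrow> 'a \<Rightarrow> 'a \<Rightarrow> 'a" +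
  assumes bul_bilinear: "bilinear_map sA sA sA (bul \<alpha>)"
    and vee_bilinear: "bilinear_map sA sA sA (vee \<alpha> \<beta>)"
    and cur_trilinear: "trilinear_map sA sA sA sA (cur \<beta> \<gamma>)"
    and sqb_trilinear: "trilinear_map sA sA sA sA (sqb \<alpha> \<beta> \<gamma>)"
    and vee_skew: "vee \<alpha> \<beta> x y = - vee \<beta> \<alpha> y x"
    and sqb_skew: "sqb \<alpha> \<beta> \<gamma> x y z = - sqb \<beta> \<alpha> \<gamma> y x z"
    and N1: "cur (\<alpha> * \<beta>) \<gamma> a (br_star \<alpha> \<beta> x y) z
      - cur \<alpha> \<gamma> (bul \<beta> y a) x z + cur \<beta> \<gamma> (bul \<alpha> x a) y z = 0"
    and N2: "cur_star \<alpha> \<beta> x y (bul \<gamma> z a) - bul \<gamma> z (cur_star \<alpha> \<beta> x y a)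
      - bul (\<alpha> * \<beta> * \<gamma>) (dbl \<alpha> \<beta> \<gamma> x y z) a = 0"
    and N3: "cur \<alpha> (\<beta> * \<gamma>) a x (br_star \<beta> \<gamma> y z)
      - bul \<beta> y (cur \<alpha> \<gamma> a x z) + bul \<gamma> z (cur \<alpha> \<beta> a x y) = 0"
    and N4: "cur_star \<alpha> \<beta> x y (cur \<gamma> \<sigma> b z a)
      - cur \<gamma> \<sigma> (cur_star \<alpha> \<beta> x y b) z a
      - cur (\<alpha> * \<beta> * \<gamma>) \<sigma> b (dbl \<alpha> \<beta> \<gamma> x y z) a
      - cur \<gamma> (\<alpha> * \<beta> * \<sigma>) b z (dbl \<alpha> \<beta> \<sigma> x y a) = 0"
    and N5: "cur \<alpha> (\<beta> * \<gamma> * \<sigma>) b x (dbl \<beta> \<gamma> \<sigma> y z a)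
      - cur \<gamma> \<sigma> (cur \<alpha> \<beta> b x y) z a
      + cur \<beta> \<sigma> (cur \<alpha> \<gamma> b x z) y a
      - cur_star \<beta> \<gamma> y z (cur \<alpha> \<sigma> b x a) = 0"
    and N6: "vee (\<alpha> * \<beta>) \<gamma> (br_star \<alpha> \<beta> x y) z
      + vee (\<beta> * \<gamma>) \<alpha> (br_star \<beta> \<gamma> y z) x
      + vee (\<gamma> * \<alpha>) \<beta> (br_star \<gamma> \<alpha> z x) y
      - bul \<gamma> z (vee \<alpha> \<beta> x y) - bul \<alpha> x (vee \<beta> \<gamma> y z) - bul \<beta> y (vee \<gamma> \<alpha> z x)
      + sqb \<alpha> \<beta> \<gamma> x y z + sqb \<beta> \<gamma> \<alpha> y z x + sqb \<gamma> \<alpha> \<beta> z x y = 0"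
    and N7: "cur \<gamma> \<sigma> (vee \<alpha> \<beta> x y) z a
      + cur \<alpha> \<sigma> (vee \<beta> \<gamma> y z) x a
      + cur \<beta> \<sigma> (vee \<gamma> \<alpha> z x) y a
      + sqb (\<alpha> * \<beta>) \<gamma> \<sigma> (br_star \<alpha> \<beta> x y) z a
      + sqb (\<beta> * \<gamma>) \<alpha> \<sigma> (br_star \<beta> \<gamma> y z) x a
      + sqb (\<gamma> * \<alpha>) \<beta> \<sigma> (br_star \<gamma> \<alpha> z x) y a = 0"
    and N8: "- bul \<gamma> z (sqb \<alpha> \<beta> \<sigma> x y a) + bul \<sigma> a (sqb \<alpha> \<beta> \<gamma> x y z)
      + sqb \<alpha> \<beta> (\<gamma> * \<sigma>) x y (br_star \<gamma> \<sigma> z a)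
      + cur_star \<alpha> \<beta> x y (vee \<gamma> \<sigma> z a)
      - vee (\<alpha> * \<beta> * \<gamma>) \<sigma> (dbl \<alpha> \<beta> \<gamma> x y z) a
      - vee \<gamma> (\<alpha> * \<beta> * \<sigma>) z (dbl \<alpha> \<beta> \<sigma> x y a) = 0"
    and N9: "- cur \<sigma> \<tau> (sqb \<alpha> \<beta> \<gamma> x y z) a b
      + cur \<gamma> \<tau> (sqb \<alpha> \<beta> \<sigma> x y a) z b
      + cur_star \<alpha> \<beta> x y (sqb \<gamma> \<sigma> \<tau> z a b)
      - cur_star \<gamma> \<sigma> z a (sqb \<alpha> \<beta> \<tau> x y b)
      - sqb (\<alpha> * \<beta> * \<gamma>) \<sigma> \<tau> (dbl \<alpha> \<beta> \<gamma> x y z) a b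
      - sqb \<gamma> (\<alpha> * \<beta> * \<sigma>) \<tau> z (dbl \<alpha> \<beta> \<sigma> x y a) b
      + sqb \<alpha> \<beta> (\<gamma> * \<sigma> * \<tau>) x y (dbl \<gamma> \<sigma> \<tau> z a b)
      - sqb \<gamma> \<sigma> (\<alpha> * \<beta> * \<tau>) z a (dbl \<alpha> \<beta> \<tau> x y b) = 0"

locale ns_lie_yamaguti_family_morphism =
  source: ns_lie_yamaguti_family sA bul vee cur sqb +
  target: ns_lie_yamaguti_family sA' bul' vee' cur' sqb' +
  Vector_Spaces.linear sA sA' f
  for sA :: "'k::field \<Rightarrow> 'a::ab_group_add \<Rightarrow> 'a"
    and bul :: "'o::ab_semigroup_mult \<Rightarrow> 'a \<Rightarrow> 'a \<Rightarrow> 'a" and vee cur sqb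
    and sA' :: "'k \<Rightarrow> 'b::ab_group_add \<Rightarrow> 'b"
    and bul' :: "'o \<Rightarrow> 'b \<Rightarrow> 'b \<Rightarrow> 'b" and vee' cur' sqb'
    and f :: "'a \<Rightarrow> 'b" +
  assumes map_bul: "f (bul \<alpha> x y) = bul' \<alpha> (f x) (f y)"
    and map_vee: "f (vee \<alpha> \<beta> x y) = vee' \<alpha> \<beta> (f x) (f y)"
    and map_cur: "f (cur \<beta> \<gamma> x y z) = cur' \<beta> \<gamma> (f x) (f y) (f z)"
    and map_sqb: "f (sqb \<alpha> \<beta> \<gamma> x y z) = sqb' \<alpha> \<beta> \<gamma> (f x) (f y) (f z)"


section \<open>The operations induced by a twisted Rota-Baxter family\<close>

definition induced_bul ::
  "('l \<Rightarrow> 'v \<Rightarrow> 'v) \<Rightarrow> ('o \<Rightarrow> 'v \<Rightarrow> 'l) \<Rightarrow> 'o \<Rightarrow> 'v \<Rightarrow> 'v \<Rightarrow> 'v"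
  where "induced_bul \<rho> T \<alpha> u v = \<rho> (T \<alpha> u) v"

definition induced_vee ::
  "('l \<Rightarrow> 'l \<Rightarrow> 'v) \<Rightarrow> ('o \<Rightarrow> 'v \<Rightarrow> 'l) \<Rightarrow> 'o \<Rightarrow> 'o \<Rightarrow> 'v \<Rightarrow> 'v \<Rightarrow> 'v"
  where "induced_vee \<Gamma>1 T \<alpha> \<beta> u v = \<Gamma>1 (T \<alpha> u) (T \<beta> v)"

definition induced_cur ::
  "('l \<Rightarrow> 'l \<Rightarrow> 'v \<Rightarrow> 'v) \<Rightarrow> ('o \<Rightarrow> 'v \<Rightarrow> 'l) \<Rightarrow> 'o \<Rightarrow> 'o \<Rightarrow> 'v \<Rightarrow> 'v \<Rightarrow> 'v \<Rightarrow> 'v"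
  where "induced_cur \<theta> T \<beta> \<gamma> u v w = \<theta> (T \<beta> v) (T \<gamma> w) u"

definition induced_sqb ::
  "('l \<Rightarrow> 'l \<Rightarrow> 'l \<Rightarrow> 'v) \<Rightarrow> ('o \<Rightarrow> 'v \<Rightarrow> 'l) \<Rightarrow> 'o \<Rightarrow> 'o \<Rightarrow> 'o \<Rightarrow> 'v \<Rightarrow> 'v \<Rightarrow> 'v \<Rightarrow> 'v"
  where "induced_sqb \<Gamma>2 T \<alpha> \<beta> \<gamma> u v w = \<Gamma>2 (T \<alpha> u) (T \<beta> v) (T \<gamma> w)"

end

theory Submission
  imports Defs
begin

text \<open>
  Composing the structure maps with the \<open>T \<alpha>\<close> makes the defining identities of the family read
  \<open>T (\<alpha> * \<beta>) [x,y]\<^sup>* = [T \<alpha> x, T \<beta> y]\<close> and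
  \<open>T (\<alpha> * \<beta> * \<gamma>) \<lbrakk>x,y,z\<rbrakk> = {T \<alpha> x, T \<beta> y, T \<gamma> z}\<close>, while \<open>{x,y,z}\<^sup>*\<close> becomes
  \<open>D (T \<alpha> x) (T \<beta> y) z\<close>. Under this dictionary (N1)--(N5) are the five axioms of a representation
  and (N6)--(N9) are the four cocycle conditions, all evaluated at images of the \<open>T \<alpha>\<close>.
\<close>

lemma linear_precompose:
  assumes "Vector_Spaces.linear s1 s2 g" and "Vector_Spaces.linear s2 s3 f"
  shows "Vector_Spaces.linear s1 s3 (\<lambda>x. f (g x))"
  using Vector_Spaces.linear_compose[OF assms] by (simp add: o_def)

text \<open>Supplies the multilinearity of the induced operations: each of them is
  \<open>\<rho>\<close>, \<open>\<theta>\<close>, \<open>\<Gamma>1\<close> or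
  \<open>\<Gamma>2\<close> with maps \<open>T \<alpha>\<close> inserted in the
  \<open>L\<close>-slots and, where there is a \<open>V\<close>-slot, the identity there.\<close>

lemma bilinear_map_precompose:
  assumes "bilinear_map sa sb sc f"
    and "Vector_Spaces.linear s1 sa g" and "Vector_Spaces.linear s2 sb h"
  shows "bilinear_map s1 s2 sc (\<lambda>x y. f (g x) (h y))"
  unfolding bilinear_map_def
proof (intro conjI allI)
  fix x y
  show "Vector_Spaces.linear s2 sc (\<lambda>y. f (g x) (h y))"
    using assms(1) by (intro linear_precompose[OF assms(3)]) (simp add: bilinear_map_def)
  show "Vector_Spaces.linear s1 sc (\<lambda>x. f (g x) (h y))"
    using assms(1)
    by (intro linear_precompose[OF assms(2), where f = "\<lambda>x. f x (h y)"])
      (simp add: bilinear_map_def)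
qed

lemma trilinear_map_precompose:
  assumes "trilinear_map sa sb sc sd f"
    and "Vector_Spaces.linear s1 sa g" and "Vector_Spaces.linear s2 sb h"
    and "Vector_Spaces.linear s3 sc k"
  shows "trilinear_map s1 s2 s3 sd (\<lambda>x y z. f (g x) (h y) (k z))"
  unfolding trilinear_map_def
proof (intro conjI allI)
  fix x y z
  show "Vector_Spaces.linear s3 sd (\<lambda>z. f (g x) (h y) (k z))"
    using assms(1) by (intro linear_precompose[OF assms(4)]) (simp add: trilinear_map_def)
  show "Vector_Spaces.linear s2 sd (\<lambda>y. f (g x) (h y) (k z))"
    using assms(1)
    by (intro linear_precompose[OF assms(3), where f = "\<lambda>y. f (g x) y (k z)"])
      (simp add: trilinear_map_def)
  show "Vector_Spaces.linear s1 sd (\<lambda>x. f (g x) (h y) (k z))"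
    using assms(1)
    by (intro linear_precompose[OF assms(2), where f = "\<lambda>x. f x (h y) (k z)"])
      (simp add: trilinear_map_def)
qed

text \<open>Needed for \<open>induced_cur\<close>, whose first argument is the vector on which
  \<open>\<theta>\<close> acts, while \<open>\<theta>\<close> itself takes that vector last.\<close>

lemma trilinear_map_rotate:
  assumes "trilinear_map sa sb sc sd f"
  shows "trilinear_map sc sa sb sd (\<lambda>z x y. f x y z)"
  using assms by (simp add: trilinear_map_def)

context twisted_rota_baxter_family
begin

text \<open>Makes the derived operations of the induced structure available before any axiom is
  known, so that the dictionary can be stated.\<close>

sublocale ns: ns_family_ops
  "induced_bul \<rho> T" "induced_vee \<Gamma>1 T" "induced_cur \<theta> T" "induced_sqb \<Gamma>2 T" .

lemma T_br_star: "T (\<alpha> * \<beta>) (ns.br_star \<alpha> \<beta> x y) = br (T \<alpha> x) (T \<beta> y)"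
  by (simp add: ns.br_star_def induced_bul_def induced_vee_def T_br)

text \<open>The two \<open>cur\<close> terms give the two \<open>\<theta>\<close> terms of
  \<open>D\<close>, and the nested \<open>bul\<close> terms give the commutator of
  \<open>\<rho>\<close>. In the last term \<open>\<rho>\<close> is taken at
  \<open>T (\<alpha> * \<beta>)\<close> of the starred bracket, which is the bracket in
  \<open>L\<close> by \<open>T_br_star\<close>.\<close>

lemma cur_star_eq_D: "ns.cur_star \<alpha> \<beta> x y z = D (T \<alpha> x) (T \<beta> y) z"
  by (simp add: ns.cur_star_def D_def induced_cur_def T_br_star)
     (simp add: induced_bul_def T_br_star)

lemma T_dbl: "T (\<alpha> * \<beta> * \<gamma>) (ns.dbl \<alpha> \<beta> \<gamma> x y z) = tri (T \<alpha> x) (T \<beta> y) (T \<gamma> z)"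
proof -
  \<comment> \<open>The right-hand side is the argument of
    \<open>T (\<alpha> * \<beta> * \<gamma>)\<close> in \<open>T_tri\<close>.\<close>
  have "ns.dbl \<alpha> \<beta> \<gamma> x y z =
    D (T \<alpha> x) (T \<beta> y) z - \<theta> (T \<alpha> x) (T \<gamma> z) y + \<theta> (T \<beta> y) (T \<gamma> z) x
      + \<Gamma>2 (T \<alpha> x) (T \<beta> y) (T \<gamma> z)"
    by (simp add: ns.dbl_def cur_star_eq_D induced_cur_def induced_sqb_def)
  then show ?thesis
    by (simp add: T_tri)
qed

text \<open>The definitions of \<open>br_star\<close> and \<open>dbl\<close> are left out on
  purpose: in the axioms both stand only under a \<open>T\<close> whose index is the matching
  product, and there they become brackets of \<open>L\<close> as a whole.\<close>

lemmas induced_translation =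
  T_br_star cur_star_eq_D T_dbl induced_bul_def induced_vee_def induced_cur_def induced_sqb_def

theorem induced_ns_lie_yamaguti_family:
  "ns_lie_yamaguti_family sV
    (induced_bul \<rho> T) (induced_vee \<Gamma>1 T) (induced_cur \<theta> T) (induced_sqb \<Gamma>2 T)"
proof
  fix \<alpha> \<beta> \<gamma> \<sigma> \<tau> and x y z a b
  show "bilinear_map sV sV sV (induced_bul \<rho> T \<alpha>)"
    unfolding induced_bul_def
    by (rule bilinear_map_precompose[OF \<rho>_bilinear T_linear V.linear_ident])
  show "bilinear_map sV sV sV (induced_vee \<Gamma>1 T \<alpha> \<beta>)"
    unfolding induced_vee_def
    by (rule bilinear_map_precompose[OF \<Gamma>1_bilinear T_linear T_linear])
  show "trilinear_map sV sV sV sV (induced_cur \<theta> T \<beta> \<gamma>)"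
    unfolding induced_cur_def
    by (rule trilinear_map_rotate)
      (rule trilinear_map_precompose[OF \<theta>_trilinear T_linear T_linear V.linear_ident])
  show "trilinear_map sV sV sV sV (induced_sqb \<Gamma>2 T \<alpha> \<beta> \<gamma>)"
    unfolding induced_sqb_def
    by (rule trilinear_map_precompose[OF \<Gamma>2_trilinear T_linear T_linear T_linear])
  show "induced_vee \<Gamma>1 T \<alpha> \<beta> x y = - induced_vee \<Gamma>1 T \<beta> \<alpha> y x"
    unfolding induced_vee_def by (rule \<Gamma>1_skew)
  show "induced_sqb \<Gamma>2 T \<alpha> \<beta> \<gamma> x y z = - induced_sqb \<Gamma>2 T \<beta> \<alpha> \<gamma> y x z"
    unfolding induced_sqb_def by (rule \<Gamma>2_skew)
  show "induced_cur \<theta> T (\<alpha> * \<beta>) \<gamma> a (ns.br_star \<alpha> \<beta> x y) z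
      - induced_cur \<theta> T \<alpha> \<gamma> (induced_bul \<rho> T \<beta> y a) x z
      + induced_cur \<theta> T \<beta> \<gamma> (induced_bul \<rho> T \<alpha> x a) y z = 0"
    unfolding induced_translation by (rule rep1)
  show "ns.cur_star \<alpha> \<beta> x y (induced_bul \<rho> T \<gamma> z a) - induced_bul \<rho> T \<gamma> z (ns.cur_star \<alpha> \<beta> x y a)
      - induced_bul \<rho> T (\<alpha> * \<beta> * \<gamma>) (ns.dbl \<alpha> \<beta> \<gamma> x y z) a = 0"
    unfolding induced_translation by (rule rep2)
  show "induced_cur \<theta> T \<alpha> (\<beta> * \<gamma>) a x (ns.br_star \<beta> \<gamma> y z)
      - induced_bul \<rho> T \<beta> y (induced_cur \<theta> T \<alpha> \<gamma> a x z)
      + induced_bul \<rho> T \<gamma> z (induced_cur \<theta> T \<alpha> \<beta> a x y) = 0"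
    unfolding induced_translation by (rule rep3)
  \<comment> \<open>Here and in the next identity \<open>b\<close> is the vector acted on, and
    \<open>x\<close>, \<open>y\<close>, \<open>z\<close>, \<open>a\<close> enter through their
    images in \<open>L\<close>.\<close>
  show "ns.cur_star \<alpha> \<beta> x y (induced_cur \<theta> T \<gamma> \<sigma> b z a)
      - induced_cur \<theta> T \<gamma> \<sigma> (ns.cur_star \<alpha> \<beta> x y b) z a
      - induced_cur \<theta> T (\<alpha> * \<beta> * \<gamma>) \<sigma> b (ns.dbl \<alpha> \<beta> \<gamma> x y z) a
      - induced_cur \<theta> T \<gamma> (\<alpha> * \<beta> * \<sigma>) b z (ns.dbl \<alpha> \<beta> \<sigma> x y a) = 0"
    unfolding induced_translation by (rule rep4)
  show "induced_cur \<theta> T \<alpha> (\<beta> * \<gamma> * \<sigma>) b x (ns.dbl \<beta> \<gamma> \<sigma> y z a)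
      - induced_cur \<theta> T \<gamma> \<sigma> (induced_cur \<theta> T \<alpha> \<beta> b x y) z a
      + induced_cur \<theta> T \<beta> \<sigma> (induced_cur \<theta> T \<alpha> \<gamma> b x z) y a
      - ns.cur_star \<beta> \<gamma> y z (induced_cur \<theta> T \<alpha> \<sigma> b x a) = 0"
    unfolding induced_translation by (rule rep5)
  show "induced_vee \<Gamma>1 T (\<alpha> * \<beta>) \<gamma> (ns.br_star \<alpha> \<beta> x y) z
      + induced_vee \<Gamma>1 T (\<beta> * \<gamma>) \<alpha> (ns.br_star \<beta> \<gamma> y z) x
      + induced_vee \<Gamma>1 T (\<gamma> * \<alpha>) \<beta> (ns.br_star \<gamma> \<alpha> z x) y
      - induced_bul \<rho> T \<gamma> z (induced_vee \<Gamma>1 T \<alpha> \<beta> x y)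
      - induced_bul \<rho> T \<alpha> x (induced_vee \<Gamma>1 T \<beta> \<gamma> y z)
      - induced_bul \<rho> T \<beta> y (induced_vee \<Gamma>1 T \<gamma> \<alpha> z x)
      + induced_sqb \<Gamma>2 T \<alpha> \<beta> \<gamma> x y z
      + induced_sqb \<Gamma>2 T \<beta> \<gamma> \<alpha> y z x
      + induced_sqb \<Gamma>2 T \<gamma> \<alpha> \<beta> z x y = 0"
    \<comment> \<open>The nine terms agree one by one and only their order differs.\<close>
    using cocycle1[of "T \<alpha> x" "T \<beta> y" "T \<gamma> z"]
    unfolding induced_translation by (simp add: algebra_simps)
  show "induced_cur \<theta> T \<gamma> \<sigma> (induced_vee \<Gamma>1 T \<alpha> \<beta> x y) z a
      + induced_cur \<theta> T \<alpha> \<sigma> (induced_vee \<Gamma>1 T \<beta> \<gamma> y z) x a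
      + induced_cur \<theta> T \<beta> \<sigma> (induced_vee \<Gamma>1 T \<gamma> \<alpha> z x) y a
      + induced_sqb \<Gamma>2 T (\<alpha> * \<beta>) \<gamma> \<sigma> (ns.br_star \<alpha> \<beta> x y) z a
      + induced_sqb \<Gamma>2 T (\<beta> * \<gamma>) \<alpha> \<sigma> (ns.br_star \<beta> \<gamma> y z) x a
      + induced_sqb \<Gamma>2 T (\<gamma> * \<alpha>) \<beta> \<sigma> (ns.br_star \<gamma> \<alpha> z x) y a = 0"
    \<comment> \<open>The second instance fills \<open>y2\<close>, the argument that stays fixed
      while \<open>x1\<close>, \<open>y1\<close>, \<open>x2\<close> are permuted cyclically; this is
      the role of \<open>a\<close>. Again only the order of the terms differs.\<close>
    using cocycle2[of "T \<alpha> x" "T \<sigma> a" "T \<beta> y" "T \<gamma> z"]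
    unfolding induced_translation by (simp add: algebra_simps)
  show "- induced_bul \<rho> T \<gamma> z (induced_sqb \<Gamma>2 T \<alpha> \<beta> \<sigma> x y a)
      + induced_bul \<rho> T \<sigma> a (induced_sqb \<Gamma>2 T \<alpha> \<beta> \<gamma> x y z)
      + induced_sqb \<Gamma>2 T \<alpha> \<beta> (\<gamma> * \<sigma>) x y (ns.br_star \<gamma> \<sigma> z a)
      + ns.cur_star \<alpha> \<beta> x y (induced_vee \<Gamma>1 T \<gamma> \<sigma> z a)
      - induced_vee \<Gamma>1 T (\<alpha> * \<beta> * \<gamma>) \<sigma> (ns.dbl \<alpha> \<beta> \<gamma> x y z) a
      - induced_vee \<Gamma>1 T \<gamma> (\<alpha> * \<beta> * \<sigma>) z (ns.dbl \<alpha> \<beta> \<sigma> x y a) = 0"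
    unfolding induced_translation by (rule cocycle3)
  \<comment> \<open>The two \<open>cur_star\<close> terms become the two \<open>D\<close> terms of
    \<open>cocycle4\<close>, and the four double brackets become the ternary brackets inside
    \<open>\<Gamma>2\<close>.\<close>
  show "- induced_cur \<theta> T \<sigma> \<tau> (induced_sqb \<Gamma>2 T \<alpha> \<beta> \<gamma> x y z) a b
      + induced_cur \<theta> T \<gamma> \<tau> (induced_sqb \<Gamma>2 T \<alpha> \<beta> \<sigma> x y a) z b
      + ns.cur_star \<alpha> \<beta> x y (induced_sqb \<Gamma>2 T \<gamma> \<sigma> \<tau> z a b)
      - ns.cur_star \<gamma> \<sigma> z a (induced_sqb \<Gamma>2 T \<alpha> \<beta> \<tau> x y b)
      - induced_sqb \<Gamma>2 T (\<alpha> * \<beta> * \<gamma>) \<sigma> \<tau> (ns.dbl \<alpha> \<beta> \<gamma> x y z) a b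
      - induced_sqb \<Gamma>2 T \<gamma> (\<alpha> * \<beta> * \<sigma>) \<tau> z (ns.dbl \<alpha> \<beta> \<sigma> x y a) b
      + induced_sqb \<Gamma>2 T \<alpha> \<beta> (\<gamma> * \<sigma> * \<tau>) x y (ns.dbl \<gamma> \<sigma> \<tau> z a b)
      - induced_sqb \<Gamma>2 T \<gamma> \<sigma> (\<alpha> * \<beta> * \<tau>) z a (ns.dbl \<alpha> \<beta> \<tau> x y b) = 0"
    unfolding induced_translation by (rule cocycle4)
qed

end

text \<open>\<open>\<zeta>\<close> passes through each structure map and leaves
  \<open>\<eta>\<close> on the \<open>L\<close>-arguments. These are of the form
  \<open>T \<alpha> u\<close>, so \<open>\<eta>\<close> is exchanged for \<open>\<zeta>\<close>
  inside \<open>T' \<alpha>\<close>.\<close>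

theorem (in twisted_rota_baxter_family_morphism) induced_ns_lie_yamaguti_family_morphism:
  "ns_lie_yamaguti_family_morphism
    sV (induced_bul \<rho> T) (induced_vee \<Gamma>1 T) (induced_cur \<theta> T) (induced_sqb \<Gamma>2 T)
    sV' (induced_bul \<rho>' T') (induced_vee \<Gamma>1' T') (induced_cur \<theta>' T') (induced_sqb \<Gamma>2' T') \<zeta>"
proof -
  \<comment> \<open>With both induced structures in place, only the four preservation equations
    remain to be proved.\<close>
  interpret S: ns_lie_yamaguti_family sV
    "induced_bul \<rho> T" "induced_vee \<Gamma>1 T" "induced_cur \<theta> T" "induced_sqb \<Gamma>2 T"
    by (rule source.induced_ns_lie_yamaguti_family)
  interpret S': ns_lie_yamaguti_family sV'
    "induced_bul \<rho>' T'" "induced_vee \<Gamma>1' T'" "induced_cur \<theta>' T'" "induced_sqb \<Gamma>2' T'"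
    by (rule target.induced_ns_lie_yamaguti_family)
  \<comment> \<open>The pointwise form of the intertwining relation, as it is met once the induced
    operations are unfolded.\<close>
  have T_map: "\<eta> (T \<alpha> u) = T' \<alpha> (\<zeta> u)" for \<alpha> u
    using T_comm by (rule comp_eq_dest)
  show ?thesis
    by unfold_locales
      (simp_all add: induced_bul_def induced_vee_def induced_cur_def induced_sqb_def
        \<rho>_comm \<theta>_comm \<Gamma>1_comm \<Gamma>2_comm T_map)
qed

theorem proposition4p8:
  fixes sL :: "'k::alg_closed_field \<Rightarrow> 'l::ab_group_add \<Rightarrow> 'l"
    and br :: "'l \<Rightarrow> 'l \<Rightarrow> 'l" and tri :: "'l \<Rightarrow> 'l \<Rightarrow> 'l \<Rightarrow> 'l"
    and sV :: "'k \<Rightarrow> 'v::ab_group_add \<Rightarrow> 'v"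
    and \<rho> :: "'l \<Rightarrow> 'v \<Rightarrow> 'v" and \<theta> :: "'l \<Rightarrow> 'l \<Rightarrow> 'v \<Rightarrow> 'v"
    and \<Gamma>1 :: "'l \<Rightarrow> 'l \<Rightarrow> 'v" and \<Gamma>2 :: "'l \<Rightarrow> 'l \<Rightarrow> 'l \<Rightarrow> 'v"
    and T :: "'o::ab_semigroup_mult \<Rightarrow> 'v \<Rightarrow> 'l"
  assumes "CHAR('k) \<noteq> 2" and "CHAR('k) \<noteq> 3"
    and "lie_yamaguti sL br tri"
    and "ly_representation sL br tri sV \<rho> \<theta>"
    and "ly_cocycle sL br tri sV \<rho> \<theta> \<Gamma>1 \<Gamma>2"
    and "twisted_rota_baxter_family sL br tri sV \<rho> \<theta> \<Gamma>1 \<Gamma>2 T"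
  shows
    "ns_lie_yamaguti_family sV
       (induced_bul \<rho> T) (induced_vee \<Gamma>1 T) (induced_cur \<theta> T) (induced_sqb \<Gamma>2 T) \<and>
     (\<forall>(sL' :: 'k \<Rightarrow> 'm::ab_group_add \<Rightarrow> 'm) br' tri'
       (sV' :: 'k \<Rightarrow> 'w::ab_group_add \<Rightarrow> 'w) \<rho>' \<theta>' \<Gamma>1' \<Gamma>2' (T' :: 'o \<Rightarrow> 'w \<Rightarrow> 'm) \<zeta> \<eta>.
       lie_yamaguti sL' br' tri' \<longrightarrow>
       ly_representation sL' br' tri' sV' \<rho>' \<theta>' \<longrightarrow>
       ly_cocycle sL' br' tri' sV' \<rho>' \<theta>' \<Gamma>1' \<Gamma>2' \<longrightarrow>
       twisted_rota_baxter_family sL' br' tri' sV' \<rho>' \<theta>' \<Gamma>1' \<Gamma>2' T' \<longrightarrow>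
       twisted_rota_baxter_family_morphism sL br tri sV \<rho> \<theta> \<Gamma>1 \<Gamma>2 T
         sL' br' tri' sV' \<rho>' \<theta>' \<Gamma>1' \<Gamma>2' T' \<zeta> \<eta> \<longrightarrow>
       ns_lie_yamaguti_family_morphism
         sV (induced_bul \<rho> T) (induced_vee \<Gamma>1 T) (induced_cur \<theta> T) (induced_sqb \<Gamma>2 T)
         sV' (induced_bul \<rho>' T') (induced_vee \<Gamma>1' T') (induced_cur \<theta>' T') (induced_sqb \<Gamma>2' T')
         \<zeta>)"
  using twisted_rota_baxter_family.induced_ns_lie_yamaguti_family[OF assms(6)]
    twisted_rota_baxter_family_morphism.induced_ns_lie_yamaguti_family_morphism
  by blast

end
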